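(* Fix an integer $b\ge 2$ and $m\in\mathbb N_0$, and let the approximation class $C^\alpha_q(L^p)$ of tensor networks be defined with $S=\mathbb P_m$ (see context). For any $\alpha>0$, any $0<p,q\le\infty$ and any $\tilde\alpha>0$, the class $C^\alpha_q(L^p)$ is not continuously embedded in $B^{\tilde\alpha}_{p,q}$: $$C^\alpha_q(L^p)\not\hookrightarrow B^{\tilde\alpha}_{p,q}.$$
   Context: All function spaces are over $[0,1)$; $\mathbb N=\{1,2,\dots\}$; $\hookrightarrow$ denotes continuous embedding. $\mathbb P_m$ is the space of polynomials of degree at most $m$. Tensor networks. Let $I_b=\{0,\dots,b-1\}$. For $d\in\mathbb N$ and $f:[0,1)\to\mathbb R$, the tensorization is $(T_{b,d}f)(i_1,\dots,i_d,y)=f\big(\sum_{k=1}^d i_kb^{-k}+b^{-d}y\big)$, $i_k\in I_b$, $y\in[0,1)$. Fix a basis $(\varphi_k)_{k=1}^{m+1}$ of $\mathbb P_m$. For $d\in\mathbb N$ and $\boldsymbol r=(r_1,\dots,r_d)\in\mathbb N^d$, a tensor network is a tuple $\mathbf v=(v_1,\dots,v_{d+1})\in\mathbb R^{b\times r_1}\times\mathbb R^{b\times r_1\times r_2}\times\cdots\times\mathbb R^{b\times r_{d-1}\times r_d}\times\mathbb R^{r_d\times(m+1)}$; its realization is the function $f$ with $$(T_{b,d}f)(i_1,\dots,i_d,y)=\sum_{k_1=1}^{r_1}\cdots\sum_{k_d=1}^{r_d}\sum_{k_{d+1}=1}^{m+1}v_1^{k_1}(i_1)v_2^{k_1,k_2}(i_2)\cdots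 v_d^{k_{d-1},k_d}(i_d)v_{d+1}^{k_d,k_{d+1}}\varphi_{k_{d+1}}(y).$$ Its complexity is $\mathrm{compl}_{\mathcal C}(\mathbf v)=br_1+b\sum_{k=2}^d r_{k-1}r_k+r_d(m+1)$. The complexity of a function is the minimum of the complexity over all tensor networks (all $d$, $\boldsymbol r$) realizing it. For $n\in\mathbb N$, $\Phi_n^{\mathcal C}$ is the set of functions realizable by tensor networks with complexity at most $n$; moreover $0\in\Phi_n^{\mathcal C}$ for all $n$ and $\Phi_0^{\mathcal C}=\{0\}$. Approximation class. With $E_n(f)=\inf_{\varphi\in\Phi^{\mathcal C}_n}\|f-\varphi\|_p$, $\alpha>0$, $0<q\le\infty$, the class $C^\alpha_q(L^p)$ consists of $f\in L^p$ with finite (quasi-)norm $\|f\|_{C^\alpha_q}=\big(\sum_{n\ge1}[n^\alpha E_{n-1}(f)]^q\frac1n\big)^{1/q}$ for $q<\infty$, and $\|f\|_{C^\alpha_\infty}=\sup_{n\ge1}n^\alpha E_{n-1}(f)$. Besov spaces. $\Delta_h[f]=f(\cdot+h)-f$, $\Delta_h^r=\Delta_h\circ\Delta_h^{r-1}$ (defined on $[0,1-rh)$), $\omega_r(f,t)_p=\sup_{0<h\le t}\|\Delta_h^r[f]\|_p$. For $\alpha>0$, $0<p,q\le\infty$, $r=\lfloor\alpha\rfloor+1$: $|f|_{B^\alpha_{p,q}}=\big(\int_0^1[t^{-\alpha}\omega_r(f,t)_p]^q\frac{dt}{t}\big)^{1/q}$ for $q<\infty$, $|f|_{B^\alpha_{p,\infty}}=\sup_{0<t\le1}t^{-\alpha}\omega_r(f,t)_p$,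 and $\|f\|_{B^\alpha_{p,q}}=\|f\|_p+|f|_{B^\alpha_{p,q}}$; $B^\alpha_{p,q}=\{f\in L^p:\|f\|_{B^\alpha_{p,q}}<\infty\}$. *)

theory Defs
  imports
    "HOL-Analysis.Analysis"
    "HOL-Probability.Essential_Supremum"
    "HOL-Computational_Algebra.Polynomial"
begin

text \<open>
  A function on \<open>[0,1)\<close> is a function \<^typ>\<open>real \<Rightarrow> real\<close> of which only the values on \<open>[0,1)\<close>
  matter. An element of \<open>L\<^sup>p\<close> is represented by any of its representatives: the (quasi-)norms
  and the classes \<open>Lp_functions\<close>, \<open>approx_class\<close>, \<open>besov_space\<close> are invariant under
  changes on null sets of \<open>[0,1)\<close>. (Realization by a tensor network is pointwise on \<open>[0,1)\<close>.)
  (Quasi-)norms take values in \<^typ>\<open>ennreal\<close>; exponents \<open>0 < p, q \<le> \<infinity>\<close> are of type \<^typ>\<open>ennreal\<close>.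
\<close>

text \<open>The power \<open>x\<^sup>s\<close> for a real exponent \<open>s > 0\<close>, with \<open>\<infinity>\<^sup>s = \<infinity>\<close>.\<close>

definition enn_rpow :: "ennreal \<Rightarrow> real \<Rightarrow> ennreal" where
  "enn_rpow x s = (if x = \<infinity> then \<infinity> else ennreal (enn2real x powr s))"


section \<open>Lebesgue spaces\<close>

definition Lp_norm_on :: "real set \<Rightarrow> ennreal \<Rightarrow> (real \<Rightarrow> real) \<Rightarrow> ennreal" where
  "Lp_norm_on A p f =
     (if p = \<infinity> then esssup (lebesgue_on A) (\<lambda>x. ennreal \<bar>f x\<bar>)
      else enn_rpow (\<integral>\<^sup>+x. ennreal (\<bar>f x\<bar> powr enn2real p) \<partial>lebesgue_on A) (1 / enn2real p))"

definition Lp_norm :: "ennreal \<Rightarrow> (real \<Rightarrow> real) \<Rightarrow> ennreal" where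
  "Lp_norm p f = Lp_norm_on {0..<1} p f"

definition Lp_functions :: "ennreal \<Rightarrow> (real \<Rightarrow> real) set" where
  "Lp_functions p = {f \<in> borel_measurable (lebesgue_on {0..<1}). Lp_norm p f < \<infinity>}"


section \<open>Tensor networks\<close>

global_interpretation poly_vs: vector_space "smult :: real \<Rightarrow> real poly \<Rightarrow> real poly"
  by unfold_locales (simp_all add: smult_add_left smult_add_right)

definition is_basis_Pm :: "nat \<Rightarrow> (nat \<Rightarrow> real poly) \<Rightarrow> bool" where
  "is_basis_Pm m \<phi> \<longleftrightarrow>
     inj_on \<phi> {1..m+1} \<and>
     poly_vs.independent (\<phi> ` {1..m+1}) \<and>
     poly_vs.span (\<phi> ` {1..m+1}) = {P. degree P \<le> m}"

definition tensorization ::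
  "nat \<Rightarrow> nat \<Rightarrow> (real \<Rightarrow> real) \<Rightarrow> (nat \<Rightarrow> nat) \<Rightarrow> real \<Rightarrow> real" where
  "tensorization b d f i y = f ((\<Sum>k=1..d. real (i k) / real b ^ k) + y / real b ^ d)"

text \<open>
  In a network with depth \<open>d\<close> and ranks \<open>r 1, \<dots>, r d\<close>, \<open>tn_first\<close> is \<open>v\<^sub>1\<close>, \<open>tn_mid j\<close> is \<open>v\<^sub>j\<close> for
  \<open>2 \<le> j \<le> d\<close>, and \<open>tn_last\<close> is \<open>v\<^bsub>d+1\<^esub>\<close>; the arguments are in the order of the array dimensions.
  Entries outside the index ranges (digits \<open>{0..<b}\<close>, rank indices \<open>{1..r j}\<close>, basis indices
  \<open>{1..m+1}\<close>) are never used.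
\<close>

record tensor_network =
  tn_depth :: nat
  tn_rank  :: "nat \<Rightarrow> nat"
  tn_first :: "nat \<Rightarrow> nat \<Rightarrow> real"
  tn_mid   :: "nat \<Rightarrow> nat \<Rightarrow> nat \<Rightarrow> nat \<Rightarrow> real"
  tn_last  :: "nat \<Rightarrow> nat \<Rightarrow> real"

definition is_tensor_network :: "tensor_network \<Rightarrow> bool" where
  "is_tensor_network v \<longleftrightarrow> 1 \<le> tn_depth v \<and> (\<forall>j\<in>{1..tn_depth v}. 1 \<le> tn_rank v j)"

definition tn_complexity :: "nat \<Rightarrow> nat \<Rightarrow> tensor_network \<Rightarrow> nat" where
  "tn_complexity b m v =
     b * tn_rank v 1
     + b * (\<Sum>k=2..tn_depth v. tn_rank v (k - 1) * tn_rank v k)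
     + tn_rank v (tn_depth v) * (m + 1)"

definition tn_contraction ::
  "nat \<Rightarrow> (nat \<Rightarrow> real poly) \<Rightarrow> tensor_network \<Rightarrow> (nat \<Rightarrow> nat) \<Rightarrow> real \<Rightarrow> real" where
  "tn_contraction m \<phi> v i y =
     (\<Sum>k\<in>(\<Pi>\<^sub>E j\<in>{1..tn_depth v}. {1..tn_rank v j}). \<Sum>l=1..m+1.
        tn_first v (i 1) (k 1)
        * (\<Prod>j=2..tn_depth v. tn_mid v j (i j) (k (j - 1)) (k j))
        * tn_last v (k (tn_depth v)) l
        * poly (\<phi> l) y)"

definition tn_realizes ::
  "nat \<Rightarrow> nat \<Rightarrow> (nat \<Rightarrow> real poly) \<Rightarrow> tensor_network \<Rightarrow> (real \<Rightarrow> real) \<Rightarrow> bool" where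
  "tn_realizes b m \<phi> v f \<longleftrightarrow>
     (\<forall>i\<in>{1..tn_depth v} \<rightarrow>\<^sub>E {0..<b}. \<forall>y\<in>{0..<1}.
        tensorization b (tn_depth v) f i y = tn_contraction m \<phi> v i y)"

text \<open>
  The zero function is adjoined for every \<open>n\<close>; since complexities are positive for \<open>b \<ge> 1\<close>,
  the set for \<open>n = 0\<close> contains nothing else.
\<close>

definition tn_functions :: "nat \<Rightarrow> nat \<Rightarrow> (nat \<Rightarrow> real poly) \<Rightarrow> nat \<Rightarrow> (real \<Rightarrow> real) set" where
  "tn_functions b m \<phi> n =
     {f. \<forall>x\<in>{0..<1}. f x = 0} \<union>
     {f. \<exists>v. is_tensor_network v \<and> tn_complexity b m v \<le> n \<and> tn_realizes b m \<phi> v f}"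


section \<open>Approximation classes\<close>

definition approx_error ::
  "nat \<Rightarrow> nat \<Rightarrow> (nat \<Rightarrow> real poly) \<Rightarrow> ennreal \<Rightarrow> nat \<Rightarrow> (real \<Rightarrow> real) \<Rightarrow> ennreal" where
  "approx_error b m \<phi> p n f = (INF g\<in>tn_functions b m \<phi> n. Lp_norm p (\<lambda>x. f x - g x))"

text \<open>The series is over \<open>n \<ge> 1\<close>, hence the shift by \<^const>\<open>Suc\<close>.\<close>

definition approx_norm ::
  "nat \<Rightarrow> nat \<Rightarrow> (nat \<Rightarrow> real poly) \<Rightarrow> real \<Rightarrow> ennreal \<Rightarrow> ennreal \<Rightarrow> (real \<Rightarrow> real) \<Rightarrow> ennreal" where
  "approx_norm b m \<phi> \<alpha> q p f =
     (if q = \<infinity>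
      then (SUP n\<in>{1..}. ennreal (real n powr \<alpha>) * approx_error b m \<phi> p (n - 1) f)
      else enn_rpow
        (\<Sum>n. enn_rpow (ennreal (real (Suc n) powr \<alpha>) * approx_error b m \<phi> p n f) (enn2real q)
              * ennreal (1 / real (Suc n)))
        (1 / enn2real q))"

definition approx_class ::
  "nat \<Rightarrow> nat \<Rightarrow> (nat \<Rightarrow> real poly) \<Rightarrow> real \<Rightarrow> ennreal \<Rightarrow> ennreal \<Rightarrow> (real \<Rightarrow> real) set" where
  "approx_class b m \<phi> \<alpha> q p = {f \<in> Lp_functions p. approx_norm b m \<phi> \<alpha> q p f < \<infinity>}"


section \<open>Besov spaces\<close>

definition fwd_diff :: "real \<Rightarrow> (real \<Rightarrow> real) \<Rightarrow> real \<Rightarrow> real" where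
  "fwd_diff h f = (\<lambda>x. f (x + h) - f x)"

text \<open>For \<open>x \<in> [0, 1 - r h)\<close> the iterated difference uses values of \<open>f\<close> on \<open>[0,1)\<close> only; if
  \<open>r h \<ge> 1\<close> the domain is empty and the norm is \<open>0\<close>.\<close>

definition modulus :: "nat \<Rightarrow> ennreal \<Rightarrow> (real \<Rightarrow> real) \<Rightarrow> real \<Rightarrow> ennreal" where
  "modulus r p f t = (SUP h\<in>{0<..t}. Lp_norm_on {0..<1 - real r * h} p ((fwd_diff h ^^ r) f))"

definition besov_seminorm ::
  "real \<Rightarrow> ennreal \<Rightarrow> ennreal \<Rightarrow> (real \<Rightarrow> real) \<Rightarrow> ennreal" where
  "besov_seminorm \<alpha> p q f =
     (let r = nat \<lfloor>\<alpha>\<rfloor> + 1 in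
      if q = \<infinity>
      then (SUP t\<in>{0<..1}. ennreal (t powr - \<alpha>) * modulus r p f t)
      else enn_rpow
        (\<integral>\<^sup>+t\<in>{0<..<1}. (enn_rpow (ennreal (t powr - \<alpha>) * modulus r p f t) (enn2real q)
                          * ennreal (1 / t)) \<partial>lborel)
        (1 / enn2real q))"

definition besov_norm ::
  "real \<Rightarrow> ennreal \<Rightarrow> ennreal \<Rightarrow> (real \<Rightarrow> real) \<Rightarrow> ennreal" where
  "besov_norm \<alpha> p q f = Lp_norm p f + besov_seminorm \<alpha> p q f"

definition besov_space :: "real \<Rightarrow> ennreal \<Rightarrow> ennreal \<Rightarrow> (real \<Rightarrow> real) set" where
  "besov_space \<alpha> p q = {f \<in> Lp_functions p. besov_norm \<alpha> p q f < \<infinity>}"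


section \<open>Continuous embedding\<close>

text \<open>Continuity of the (linear) inclusion map between quasi-normed spaces, i.e. boundedness.\<close>

definition continuously_embedded ::
  "'a set \<Rightarrow> ('a \<Rightarrow> ennreal) \<Rightarrow> 'a set \<Rightarrow> ('a \<Rightarrow> ennreal) \<Rightarrow> bool" where
  "continuously_embedded X normX Y normY \<longleftrightarrow>
     X \<subseteq> Y \<and> (\<exists>C::real. C \<ge> 0 \<and> (\<forall>f\<in>X. normY f \<le> ennreal C * normX f))"

end

theory Submission
  imports Defs "HOL-Real_Asymp.Real_Asymp"
begin

text \<open>
  Depth gives a tensor network frequency almost for free. Let \<open>f\<^sub>d\<close> be the indicator of the set
  where the \<open>d\<close>-th base-\<open>b\<close> digit vanishes. It is a product of functions of single digits, so a
  network with all ranks \<open>1\<close> realizes it (\<open>digit_zero_tn\<close>), at complexity \<open>N = b d + m + 1\<close>. Its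
  approximation errors are therefore at most \<open>1\<close>, and zero from \<open>N\<close> on, which bounds the
  approximation norm by \<open>N\<close> to the power \<open>\<alpha> + 1/q\<close> (\<open>approx_norm_le\<close>): polynomial growth in \<open>d\<close>.

  On the other hand \<open>f\<^sub>d\<close> oscillates at scale \<open>b\<^sup>-\<^sup>d\<close>. With \<open>r = \<lfloor>\<alpha>'\<rfloor> + 1\<close> and a step \<open>h\<close> of that order, the
  \<open>r\<close>-th difference of \<open>f\<^sub>d\<close> has modulus \<open>1\<close> on a set whose measure does not depend on \<open>d\<close>
  (\<open>digit_zero_diff_norm_ge\<close>). The modulus of smoothness at \<open>h\<close> is thus bounded below, and the weight
  \<open>t powr -\<alpha>'\<close> in the Besov seminorm makes the Besov norm at least a constant times \<open>b\<close> to the power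
  \<open>d \<alpha>'\<close> (\<open>besov_norm_ge\<close>): exponential growth in \<open>d\<close>. No constant can bound the second norm by the
  first.
\<close>


section \<open>Powers and norms in the extended nonnegative reals\<close>

lemma enn_rpow_mono:
  assumes "x \<le> y" "0 \<le> s"
  shows "enn_rpow x s \<le> enn_rpow y s"
proof (cases "y = \<infinity>")
  case False
  then have "y < \<infinity>" "x < \<infinity>"
    using assms(1) by (auto simp: top.not_eq_extremum)
  then show ?thesis
    using assms by (auto simp: enn_rpow_def intro!: ennreal_leI powr_mono2 enn2real_mono)
qed (simp add: enn_rpow_def)

lemma enn_rpow_ennreal: "0 \<le> x \<Longrightarrow> enn_rpow (ennreal x) s = ennreal (x powr s)"
  by (simp add: enn_rpow_def)

lemma Lp_norm_zero: "Lp_norm p (\<lambda>x. 0) = 0"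
proof -
  have "esssup (lebesgue_on {0..<1::real}) (\<lambda>x. 0::ennreal) \<le> 0"
    by (intro esssup_I) auto
  then show ?thesis
    by (simp add: Lp_norm_def Lp_norm_on_def enn_rpow_def)
qed

lemma Lp_norm_le_1:
  assumes f: "f \<in> borel_measurable (lebesgue_on {0..<1})" and le1: "\<And>x. \<bar>f x\<bar> \<le> 1"
  shows "Lp_norm p f \<le> 1"
proof (cases "p = \<infinity>")
  case True
  have "esssup (lebesgue_on {0..<1::real}) (\<lambda>x. ennreal \<bar>f x\<bar>) \<le> 1"
    using f le1 by (intro esssup_I) (auto simp flip: ennreal_1 intro!: ennreal_leI)
  then show ?thesis
    using True by (simp add: Lp_norm_def Lp_norm_on_def)
next
  case False
  have "(\<integral>\<^sup>+x. ennreal (\<bar>f x\<bar> powr enn2real p) \<partial>lebesgue_on {0..<1})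
        \<le> (\<integral>\<^sup>+x. 1 \<partial>lebesgue_on {0..<1::real})"
    using le1 by (intro nn_integral_mono)
      (auto simp flip: ennreal_1 intro!: ennreal_leI powr_le1)
  also have "\<dots> = ennreal 1"
    by (simp add: emeasure_restrict_space)
  finally have "Lp_norm p f \<le> enn_rpow (ennreal 1) (1 / enn2real p)"
    using False by (simp only: Lp_norm_def Lp_norm_on_def if_False) (intro enn_rpow_mono; simp)
  then show ?thesis
    by (simp add: enn_rpow_def)
qed

text \<open>
  For \<open>p = \<infinity>\<close> the exponent \<open>1 / enn2real p\<close> is \<open>1 / 0 = 0\<close>, so that one formula covers all \<open>p\<close>.
\<close>

lemma Lp_norm_on_ge:
  assumes A: "A \<in> sets lebesgue" and S: "S \<in> sets lebesgue" "S \<subseteq> A"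
    and \<mu>: "emeasure lebesgue S = ennreal \<mu>" "0 < \<mu>"
    and g: "\<And>x. x \<in> S \<Longrightarrow> 1 \<le> \<bar>g x\<bar>"
  shows "ennreal (\<mu> powr (1 / enn2real p)) \<le> Lp_norm_on A p g"
proof (cases "p = \<infinity>")
  case True
  have SA: "S \<in> sets (lebesgue_on A)"
    using A S by (simp add: sets_restrict_space_iff)
  have emS: "emeasure (lebesgue_on A) S = ennreal \<mu>"
    using A S \<mu> by (simp add: emeasure_restrict_space)
  have "1 \<le> esssup (lebesgue_on A) (\<lambda>x. ennreal \<bar>g x\<bar>)"
  proof (rule ccontr)
    assume less: "\<not> ?thesis"
    have "AE x in lebesgue_on A. ennreal \<bar>g x\<bar> \<le> esssup (lebesgue_on A) (\<lambda>x. ennreal \<bar>g x\<bar>)"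
      by (rule esssup_AE)
    then have "AE x in lebesgue_on A. x \<notin> S"
    proof (rule AE_mp, intro AE_I2 impI notI)
      fix x assume *: "ennreal \<bar>g x\<bar> \<le> esssup (lebesgue_on A) (\<lambda>x. ennreal \<bar>g x\<bar>)" "x \<in> S"
      have "1 \<le> ennreal \<bar>g x\<bar>"
        using g[OF *(2)] by (metis ennreal_1 ennreal_leI)
      with * less show False by (meson order_trans)
    qed
    then have "emeasure (lebesgue_on A) S = 0"
      using SA by (metis AE_iff_null_sets null_setsD1)
    with emS \<mu> show False by simp
  qed
  then show ?thesis
    using True \<mu> by (simp add: Lp_norm_on_def)
next
  case False
  have "ennreal \<mu> = (\<integral>\<^sup>+x. indicator S x \<partial>lebesgue_on A)"
    using A S \<mu> by (simp add: sets_restrict_space_iff emeasure_restrict_space)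
  also have "\<dots> \<le> (\<integral>\<^sup>+x. ennreal (\<bar>g x\<bar> powr enn2real p) \<partial>lebesgue_on A)"
    using g by (intro nn_integral_mono)
      (auto simp: indicator_def ge_one_powr_ge_zero simp flip: ennreal_1 intro!: ennreal_leI)
  finally have "enn_rpow (ennreal \<mu>) (1 / enn2real p) \<le> Lp_norm_on A p g"
    using False by (simp only: Lp_norm_on_def if_False) (intro enn_rpow_mono; simp)
  then show ?thesis
    using \<mu> by (simp add: enn_rpow_ennreal)
qed


section \<open>Indicators of a digit and their networks\<close>

definition digit_zero :: "nat \<Rightarrow> nat \<Rightarrow> real \<Rightarrow> real" where
  "digit_zero b d x = of_bool (\<lfloor>real b ^ d * x\<rfloor> mod int b = 0)"

lemma digit_zero_bounds: "\<bar>digit_zero b d x\<bar> \<le> 1"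
  by (simp add: digit_zero_def)

lemma digit_zero_measurable: "digit_zero b d \<in> borel_measurable (lebesgue_on {0..<1})"
proof -
  have "(\<lambda>x. of_bool (\<lfloor>real b ^ d * x\<rfloor> mod int b = 0) :: real) \<in> borel_measurable borel"
    by measurable
  then have "digit_zero b d \<in> borel_measurable lborel"
    unfolding digit_zero_def[abs_def] by simp
  then show ?thesis
    by (intro measurable_restrict_space1 measurable_completion)
qed

text \<open>
  Multiplication by \<open>b ^ d\<close> turns the expansion into an integer congruent to \<open>i d\<close> modulo \<open>b\<close>,
  plus the fractional part \<open>y\<close>.
\<close>

lemma digit_zero_expansion:
  assumes b: "2 \<le> b" and d: "1 \<le> d" and i: "i d < b" and y: "0 \<le> y" "y < 1"
  shows "digit_zero b d ((\<Sum>k=1..d. real (i k) / real b ^ k) + y / real b ^ d)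
         = of_bool (i d = 0)"
proof -
  define s where "s = (\<Sum>k=1..<d. i k * b ^ (d - k - 1))"
  have "real b ^ d * (\<Sum>k=1..d. real (i k) / real b ^ k)
        = (\<Sum>k=1..d. real (i k) * real b ^ (d - k))"
    using b by (auto simp: sum_distrib_left power_diff intro!: sum.cong)
  also have "\<dots> = (\<Sum>k=1..<d. real (i k) * real b ^ (d - k)) + real (i d)"
    using d by (subst sum.last_plus) auto
  also have "(\<Sum>k=1..<d. real (i k) * real b ^ (d - k)) = real (b * s)"
    unfolding s_def of_nat_mult of_nat_sum sum_distrib_left
    by (intro sum.cong) (auto simp flip: power_Suc intro!: arg_cong[where f="(^) (real b)"])
  finally have "real b ^ d * ((\<Sum>k=1..d. real (i k) / real b ^ k) + y / real b ^ d)
      = real_of_int (int (b * s + i d)) + y"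
    using b by (simp add: distrib_left)
  moreover have "\<lfloor>real_of_int (int (b * s + i d)) + y\<rfloor> = int (b * s + i d)"
    using y by (intro floor_unique) auto
  ultimately show ?thesis
    using i by (simp only: digit_zero_def flip: of_nat_mod) simp
qed

lemma basis_represents_one:
  assumes "is_basis_Pm m \<phi>"
  obtains c where "\<And>y. (\<Sum>l=1..m+1. c l * poly (\<phi> l) y) = 1"
proof -
  have "1 \<in> poly_vs.span (\<phi> ` {1..m+1})" and inj: "inj_on \<phi> {1..m+1}"
    using assms by (auto simp: is_basis_Pm_def)
  then obtain u where "1 = (\<Sum>v\<in>\<phi> ` {1..m+1}. smult (u v) v)"
    by (subst (asm) poly_vs.span_finite) auto
  also have "\<dots> = (\<Sum>l=1..m+1. smult (u (\<phi> l)) (\<phi> l))"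
    using inj by (subst sum.reindex) auto
  finally have one: "1 = (\<Sum>l=1..m+1. smult (u (\<phi> l)) (\<phi> l))" .
  have "poly 1 y = (\<Sum>l=1..m+1. u (\<phi> l) * poly (\<phi> l) y)" for y
    by (subst one) (simp only: poly_sum poly_smult)
  then show thesis
    by (intro that[of "\<lambda>l. u (\<phi> l)"]) simp
qed

text \<open>
  The core at position \<open>d\<close> tests the digit, all other cores are constant \<open>1\<close>, and the last one holds
  the coefficients of the constant polynomial \<open>1\<close>. For \<open>d = 1\<close> the digit
  would have to be tested by the first core, which has a different shape; hence \<open>2 \<le> d\<close>.
\<close>

lemma digit_zero_tn:
  assumes b: "2 \<le> b" and d: "2 \<le> d" and \<phi>: "is_basis_Pm m \<phi>"
  shows "digit_zero b d \<in> tn_functions b m \<phi> (b * d + m + 1)"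
proof -
  obtain c where c: "\<And>y. (\<Sum>l=1..m+1. c l * poly (\<phi> l) y) = 1"
    using basis_represents_one[OF \<phi>] by blast
  define v where "v = \<lparr>tn_depth = d, tn_rank = (\<lambda>_. 1), tn_first = (\<lambda>_ _. 1),
    tn_mid = (\<lambda>j i _ _. if j = d then of_bool (i = 0) else 1), tn_last = (\<lambda>_. c)\<rparr>"
  have "is_tensor_network v"
    using d by (simp add: is_tensor_network_def v_def)
  moreover have "tn_complexity b m v \<le> b * d + m + 1"
  proof -
    have "b + b * (d - 1) = b * d"
      using d by (cases d) auto
    then show ?thesis
      by (simp add: tn_complexity_def v_def)
  qed
  moreover have "tn_realizes b m \<phi> v (digit_zero b d)"
    unfolding tn_realizes_def
  proof (intro ballI)
    fix i y assume i: "i \<in> {1..tn_depth v} \<rightarrow>\<^sub>E {0..<b}" and y: "y \<in> {0..<1::real}"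
    have "i d < b"
      using i d by (force simp: v_def PiE_iff)
    then have "tensorization b (tn_depth v) (digit_zero b d) i y = of_bool (i d = 0)"
      using digit_zero_expansion[of b d i y] b d y by (simp add: tensorization_def v_def)
    also have "\<dots> = tn_contraction m \<phi> v i y"
    proof -
      have "({1..d} \<rightarrow>\<^sub>E {1..1::nat}) = {\<lambda>j\<in>{1..d}. 1}"
        by (auto simp: PiE_iff extensional_def fun_eq_iff)
      moreover have "(\<Prod>j=2..d. if j = d then of_bool (i j = 0) else 1) = (of_bool (i d = 0) :: real)"
        using d by (subst prod.delta) auto
      ultimately have "tn_contraction m \<phi> v i y
          = of_bool (i d = 0) * (\<Sum>l=1..m+1. c l * poly (\<phi> l) y)"
        unfolding tn_contraction_def v_def
        by (simp add: sum_distrib_left mult.assoc del: sum.cl_ivl_Suc)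
      then show ?thesis using c by simp
    qed
    finally show "tensorization b (tn_depth v) (digit_zero b d) i y = tn_contraction m \<phi> v i y" .
  qed
  ultimately show ?thesis
    unfolding tn_functions_def by blast
qed


section \<open>The approximation norm of a function of small complexity\<close>

text \<open>
  Only the first \<open>N\<close> errors can be nonzero, and they are at most \<open>1\<close> because \<open>0\<close> is always a
  competitor. For finite \<open>q\<close> the crude bound \<open>N powr (\<alpha> q)\<close> on each of the \<open>N\<close> summands yields the
  additional \<open>1 / q\<close> in the exponent; for \<open>q = \<infinity>\<close> that term is \<open>1 / 0 = 0\<close>.
\<close>

lemma approx_norm_le:
  assumes f: "f \<in> tn_functions b m \<phi> N" and f1: "Lp_norm p f \<le> 1"
    and \<alpha>: "0 < \<alpha>" and q: "0 < q" and N: "1 \<le> N"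
  shows "approx_norm b m \<phi> \<alpha> q p f \<le> ennreal (real N powr (\<alpha> + 1 / enn2real q))"
proof -
  have E0: "approx_error b m \<phi> p n f = 0" if "N \<le> n" for n
  proof -
    have "f \<in> tn_functions b m \<phi> n"
      using f that by (fastforce simp: tn_functions_def)
    then have "approx_error b m \<phi> p n f \<le> Lp_norm p (\<lambda>x. f x - f x)"
      unfolding approx_error_def by (rule INF_lower)
    then show ?thesis by (simp add: Lp_norm_zero)
  qed
  have E1: "approx_error b m \<phi> p n f \<le> 1" for n
  proof -
    have "(\<lambda>_. 0) \<in> tn_functions b m \<phi> n"
      by (simp add: tn_functions_def)
    then have "approx_error b m \<phi> p n f \<le> Lp_norm p (\<lambda>x. f x - 0)"
      unfolding approx_error_def by (rule INF_lower)
    with f1 show ?thesis by simp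
  qed
  have summand: "ennreal (real (Suc n) powr \<alpha>) * approx_error b m \<phi> p n f \<le> ennreal (real N powr \<alpha>)" for n
  proof (cases "N \<le> n")
    case False
    have "ennreal (real (Suc n) powr \<alpha>) * approx_error b m \<phi> p n f \<le> ennreal (real N powr \<alpha>) * 1"
      using False \<alpha> E1 by (intro mult_mono ennreal_leI powr_mono2) auto
    then show ?thesis by simp
  qed (simp add: E0)
  show ?thesis
  proof (cases "q = \<infinity>")
    case True
    have "ennreal (real n powr \<alpha>) * approx_error b m \<phi> p (n - 1) f \<le> ennreal (real N powr \<alpha>)"
      if "n \<in> {1..}" for n
      using summand[of "n - 1"] that by simp
    then show ?thesis
      using True unfolding approx_norm_def by (auto intro!: SUP_least)
  next
    case False
    define s where "s = enn2real q"
    have s: "0 < s"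
      using False q by (simp add: s_def enn2real_positive_iff top.not_eq_extremum)
    let ?a = "\<lambda>n. enn_rpow (ennreal (real (Suc n) powr \<alpha>) * approx_error b m \<phi> p n f) s
              * ennreal (1 / real (Suc n))"
    have "?a n \<le> ennreal (real N powr (\<alpha> * s))" for n
    proof -
      have "?a n \<le> enn_rpow (ennreal (real N powr \<alpha>)) s * ennreal 1"
        using s by (intro mult_mono enn_rpow_mono summand ennreal_leI) auto
      then show ?thesis by (simp add: enn_rpow_ennreal powr_powr)
    qed
    then have "sum ?a {..<N} \<le> (\<Sum>n<N. ennreal (real N powr (\<alpha> * s)))"
      by (intro sum_mono)
    also have "\<dots> = ennreal (real N * real N powr (\<alpha> * s))"
      by (simp add: ennreal_mult ennreal_of_nat_eq_real_of_nat)
    also have "\<dots> = ennreal (real N powr (\<alpha> * s + 1))"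
      using N by (simp add: powr_add mult.commute)
    also have "sum ?a {..<N} = suminf ?a"
      using s by (intro suminf_finite[symmetric]) (auto simp: E0 enn_rpow_def)
    finally have "enn_rpow (suminf ?a) (1 / s) \<le> enn_rpow (ennreal (real N powr (\<alpha> * s + 1))) (1 / s)"
      using s by (intro enn_rpow_mono) auto
    also have "\<dots> = ennreal (real N powr ((\<alpha> * s + 1) * (1 / s)))"
      by (simp only: enn_rpow_ennreal powr_ge_zero powr_powr)
    also have "(\<alpha> * s + 1) * (1 / s) = \<alpha> + 1 / s"
      using s by (simp add: field_simps)
    finally show ?thesis
      using False by (simp add: approx_norm_def s_def)
  qed
qed


section \<open>Differences of the digit indicator\<close>

lemma fwd_diff_funpow_Suc:
  "(fwd_diff h ^^ Suc r) f x = (fwd_diff h ^^ r) f (x + h) - (fwd_diff h ^^ r) f x"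
proof -
  have "fwd_diff h g x = g (x + h) - g x" for g
    by (simp add: fwd_diff_def)
  then show ?thesis by simp
qed

lemma fwd_diff_funpow_zero:
  assumes "\<And>k. k \<le> r \<Longrightarrow> f (x + real k * h) = 0"
  shows "(fwd_diff h ^^ r) f x = 0"
  using assms
proof (induction r arbitrary: x)
  case (Suc r)
  have "(fwd_diff h ^^ r) f (x + h) = 0"
  proof (rule Suc.IH)
    fix k assume "k \<le> r"
    then show "f (x + h + real k * h) = 0"
      using Suc.prems[of "Suc k"] by (simp add: algebra_simps)
  qed
  moreover have "(fwd_diff h ^^ r) f x = 0"
    using Suc by simp
  ultimately show ?case by (simp add: fwd_diff_funpow_Suc del: funpow.simps)
qed simp

text \<open>
  Of the \<open>r + 1\<close> sample points of an \<open>r\<close>-th difference only the first contributes, so the binomial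
  expansion of the difference is not needed.
\<close>

lemma fwd_diff_funpow_first:
  assumes "\<And>k. 1 \<le> k \<Longrightarrow> k \<le> r \<Longrightarrow> f (x + real k * h) = 0"
  shows "(fwd_diff h ^^ r) f x = (-1) ^ r * f x"
  using assms
proof (induction r)
  case (Suc r)
  have "(fwd_diff h ^^ r) f (x + h) = 0"
  proof (rule fwd_diff_funpow_zero)
    fix k assume "k \<le> r"
    then show "f (x + h + real k * h) = 0"
      using Suc.prems[of "Suc k"] by (simp add: algebra_simps)
  qed
  moreover have "(fwd_diff h ^^ r) f x = (-1) ^ r * f x"
    using Suc by simp
  ultimately show ?case by (simp add: fwd_diff_funpow_Suc del: funpow.simps)
qed simp

text \<open>
  A cell of length \<open>w = 1 / b ^ d\<close> where the digit is \<open>0\<close> is followed by one where it is \<open>1\<close>. The step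
  \<open>h = w / r\<close> is so short that from the last piece of length \<open>h\<close> of the first cell all \<open>r\<close>
  translates fall into the second one, where the indicator vanishes: no cancellation between the
  binomial terms can occur, as it might with step \<open>w\<close>. There are \<open>b ^ (d - 1)\<close> such pieces, of total
  measure \<open>1 / (b r)\<close>. A single piece would not suffice, as its measure decays like \<open>b\<close> to the power
  \<open>-d\<close>.
\<close>

lemma digit_zero_diff_norm_ge:
  assumes b: "2 \<le> b" and d: "1 \<le> d" and r: "1 \<le> r"
  defines "h \<equiv> 1 / (real r * real b ^ d)"
  shows "ennreal ((1 / (real b * real r)) powr (1 / enn2real p))
         \<le> Lp_norm_on {0..<1 - real r * h} p ((fwd_diff h ^^ r) (digit_zero b d))"
proof -
  define w where "w = 1 / real b ^ d"
  have w: "0 < w" "real b ^ d * w = 1" and h: "0 < h" "real r * h = w" "h \<le> w"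
    using b r by (auto simp: w_def h_def field_simps)
  define J where "J j = {real j * real b * w + w - h ..< real j * real b * w + w}" for j :: nat
  define S where "S = (\<Union>j<b ^ (d - 1). J j)"
  have bd: "real b ^ d = real b * real b ^ (d - 1)"
    using d by (simp flip: power_Suc)
  have grid: "real j * real b * w + real b * w \<le> 1" if "j < b ^ (d - 1)" for j
  proof -
    have "real (Suc j) \<le> real (b ^ (d - 1))"
      using that by (intro of_nat_mono) simp
    then have "(real j + 1) * (real b * w) \<le> real b ^ (d - 1) * (real b * w)"
      using w by (intro mult_right_mono) auto
    also have "\<dots> = 1" using w bd by (simp add: mult.assoc mult.left_commute)
    finally show ?thesis by (simp add: algebra_simps)
  qed
  have bw: "2 * w \<le> real b * w"
    using b w by (intro mult_right_mono) auto
  have "1 \<le> \<bar>(fwd_diff h ^^ r) (digit_zero b d) x\<bar>" if "x \<in> S" for x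
  proof -
    obtain j where j: "real j * real b * w + w - h \<le> x" "x < real j * real b * w + w"
      using \<open>x \<in> S\<close> by (auto simp: S_def J_def)
    have scale: "real b ^ d * (real j * real b * w + c * w) = real j * real b + c" for c
      using w(2) by (simp add: algebra_simps)
    have floor: "\<lfloor>real b ^ d * z\<rfloor> = int (j * b + n)"
      if "real j * real b * w + real n * w \<le> z" "z < real j * real b * w + (real n + 1) * w" for z n
    proof (rule floor_unique)
      have "real b ^ d * (real j * real b * w + real n * w) \<le> real b ^ d * z"
        using that by (intro mult_left_mono) auto
      then show "real_of_int (int (j * b + n)) \<le> real b ^ d * z" by (simp add: scale)
      have "real b ^ d * z < real b ^ d * (real j * real b * w + (real n + 1) * w)"
        using that b by (intro mult_strict_left_mono) auto
      then show "real b ^ d * z < real_of_int (int (j * b + n)) + 1" by (simp add: scale)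
    qed
    have "digit_zero b d x = 1"
      using floor[of 0 x] j h by (simp add: digit_zero_def)
    moreover have "digit_zero b d (x + real k * h) = 0" if k: "1 \<le> k" "k \<le> r" for k
    proof -
      have kh: "1 * h \<le> real k * h" "real k * h \<le> real r * h"
        using k h by (intro mult_right_mono; simp)+
      have "real j * real b * w + real 1 * w \<le> x + real k * h"
        using j kh unfolding of_nat_1 mult_1 by linarith
      moreover have "x + real k * h < real j * real b * w + (real 1 + 1) * w"
        using j kh h unfolding of_nat_1 mult_1 distrib_right by linarith
      ultimately have "\<lfloor>real b ^ d * (x + real k * h)\<rfloor> = int (j * b + 1)"
        by (rule floor)
      moreover have "int (j * b + 1) mod int b = 1"
        using b by (simp only: mod_mult_self3 flip: of_nat_mod) simp
      ultimately show ?thesis by (simp only: digit_zero_def) simp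
    qed
    ultimately have "(fwd_diff h ^^ r) (digit_zero b d) x = (-1) ^ r"
      by (subst fwd_diff_funpow_first) auto
    then show ?thesis by (simp add: power_abs)
  qed
  moreover have "S \<subseteq> {0..<1 - real r * h}"
  proof
    fix x assume "x \<in> S"
    then obtain j where j: "j < b ^ (d - 1)"
        "real j * real b * w + w - h \<le> x" "x < real j * real b * w + w"
      by (auto simp: S_def J_def)
    have "0 \<le> real j * real b * w" using w by simp
    then have "0 \<le> x" "x < 1 - real r * h"
      using j grid[OF j(1)] bw h by linarith+
    then show "x \<in> {0..<1 - real r * h}" by simp
  qed
  moreover have "emeasure lebesgue S = ennreal (1 / (real b * real r))"
  proof -
    have "J j \<inter> J k = {}" if "j < k" for j k
    proof -
      have "real (j + 1) * (real b * w) \<le> real k * (real b * w)"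
        using that w by (intro mult_right_mono) (auto simp flip: of_nat_Suc)
      then have "real j * real b * w + real b * w \<le> real k * real b * w"
        by (simp add: algebra_simps)
      then have "real j * real b * w + w \<le> real k * real b * w + w - h"
        using bw h by linarith
      then show ?thesis by (auto simp: J_def)
    qed
    then have "disjoint_family_on J {..<b ^ (d - 1)}"
      unfolding disjoint_family_on_def by (metis Int_commute linorder_neqE_nat)
    moreover have "J ` {..<b ^ (d - 1)} \<subseteq> sets lebesgue"
      by (auto simp: J_def)
    ultimately have "emeasure lebesgue S = (\<Sum>j<b ^ (d - 1). emeasure lebesgue (J j))"
      unfolding S_def by (intro sum_emeasure[symmetric]) simp_all
    also have "\<dots> = (\<Sum>j<b ^ (d - 1). ennreal h)"
      using h by (simp add: J_def)
    also have "\<dots> = ennreal (real (b ^ (d - 1)) * h)"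
      using h by (simp add: ennreal_mult ennreal_of_nat_eq_real_of_nat)
    also have "real (b ^ (d - 1)) * h = 1 / (real b * real r)"
      using b by (simp add: h_def bd)
    finally show ?thesis .
  qed
  moreover have "S \<in> sets lebesgue"
    by (simp add: S_def J_def)
  ultimately show ?thesis
    using b r by (intro Lp_norm_on_ge[of _ S]) simp_all
qed


section \<open>The Besov norm\<close>

text \<open>
  The modulus of smoothness is nondecreasing in \<open>t\<close>, so the lower bound at \<open>h\<close> persists on
  \<open>[h, 2h]\<close>, an interval of measure at least \<open>1/2\<close> for \<open>dt/t\<close>.
\<close>

lemma besov_norm_ge:
  assumes h: "0 < h" "h \<le> 1/2" and \<alpha>: "0 < \<alpha>" and q: "0 < q" and c: "0 \<le> c"
    and diff: "ennreal c \<le> Lp_norm_on {0..<1 - real (nat \<lfloor>\<alpha>\<rfloor> + 1) * h} p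
                              ((fwd_diff h ^^ (nat \<lfloor>\<alpha>\<rfloor> + 1)) f)"
  shows "ennreal ((2 * h) powr - \<alpha> * c * (1/2) powr (1 / enn2real q)) \<le> besov_norm \<alpha> p q f"
proof -
  define r where "r = nat \<lfloor>\<alpha>\<rfloor> + 1"
  have mod: "ennreal ((2 * h) powr - \<alpha> * c) \<le> ennreal (t powr - \<alpha>) * modulus r p f t"
    if t: "h \<le> t" "t \<le> 2 * h" for t
  proof -
    have "ennreal c \<le> modulus r p f t"
      unfolding modulus_def using h t diff by (intro SUP_upper2[of h]) (auto simp: r_def)
    moreover have "(2 * h) powr - \<alpha> \<le> t powr - \<alpha>"
      using t h \<alpha> by (intro powr_mono2') auto
    ultimately show ?thesis
      using c by (subst ennreal_mult) (auto intro!: mult_mono ennreal_leI)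
  qed
  have "ennreal ((2 * h) powr - \<alpha> * c * (1/2) powr (1 / enn2real q)) \<le> besov_seminorm \<alpha> p q f"
  proof (cases "q = \<infinity>")
    case True
    have "ennreal ((2 * h) powr - \<alpha> * c) \<le> (SUP t\<in>{0<..1}. ennreal (t powr - \<alpha>) * modulus r p f t)"
      using h by (intro SUP_upper2[of h] mod) auto
    then show ?thesis
      using True by (simp add: besov_seminorm_def r_def)
  next
    case False
    define s where "s = enn2real q"
    have s: "0 < s"
      using False q by (simp add: s_def enn2real_positive_iff top.not_eq_extremum)
    let ?C = "((2 * h) powr - \<alpha> * c) powr s"
    let ?I = "\<lambda>t. enn_rpow (ennreal (t powr - \<alpha>) * modulus r p f t) s * ennreal (1 / t)"
    have "ennreal (?C * (1/2)) = ennreal (?C * (1 / (2 * h))) * ennreal h"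
      using h by (simp flip: ennreal_mult)
    also have "\<dots> = (\<integral>\<^sup>+t. ennreal (?C * (1 / (2 * h))) * indicator {h<..<2*h} t \<partial>lborel)"
      using h by (subst nn_integral_cmult_indicator) auto
    also have "\<dots> \<le> (\<integral>\<^sup>+t\<in>{0<..<1}. ?I t \<partial>lborel)"
    proof (intro nn_integral_mono)
      fix t :: real
      show "ennreal (?C * (1 / (2 * h))) * indicator {h<..<2*h} t \<le> ?I t * indicator {0<..<1} t"
      proof (cases "t \<in> {h<..<2*h}")
        case True
        have "ennreal (?C * (1 / (2 * h)))
              = enn_rpow (ennreal ((2 * h) powr - \<alpha> * c)) s * ennreal (1 / (2 * h))"
          using h c by (simp add: enn_rpow_ennreal ennreal_mult flip: ennreal_mult)
        also have "\<dots> \<le> ?I t"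
          using True h s by (intro mult_mono enn_rpow_mono mod ennreal_leI divide_left_mono) auto
        finally show ?thesis using True h by simp
      qed simp
    qed
    finally have "enn_rpow (ennreal (?C * (1/2))) (1 / s) \<le> besov_seminorm \<alpha> p q f"
      using False s
      by (simp only: besov_seminorm_def Let_def if_False r_def s_def) (intro enn_rpow_mono; simp)
    moreover have "(?C * (1/2)) powr (1 / s) = (2 * h) powr - \<alpha> * c * (1/2) powr (1 / s)"
      using s c by (simp only: powr_mult powr_powr) simp
    ultimately show ?thesis
      by (simp add: enn_rpow_ennreal s_def)
  qed
  then show ?thesis
    unfolding besov_norm_def by (simp add: add_increasing)
qed

lemma exponential_beats_power:
  fixes b C c \<alpha> \<beta> a :: real
  assumes "1 < b" "0 < c" "0 < \<alpha>" "0 < a"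
  shows "\<exists>d\<ge>2. C * (b * real d + a) powr \<beta> < c * (b ^ d) powr \<alpha>"
proof -
  have "(\<lambda>d. C * (b * real d + a) powr \<beta> / (c * (b ^ d) powr \<alpha>)) \<longlonglongrightarrow> 0"
    using assms by real_asymp
  then have "\<forall>\<^sub>F d in sequentially. C * (b * real d + a) powr \<beta> / (c * (b ^ d) powr \<alpha>) < 1"
    by (rule order_tendstoD) simp
  with eventually_ge_at_top[of 2]
  have "\<forall>\<^sub>F d in sequentially. 2 \<le> d \<and> C * (b * real d + a) powr \<beta> / (c * (b ^ d) powr \<alpha>) < 1"
    by eventually_elim auto
  then obtain d where "2 \<le> d" "C * (b * real d + a) powr \<beta> / (c * (b ^ d) powr \<alpha>) < 1"
    by (auto simp: eventually_at_top_linorder)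
  moreover have "0 < c * (b ^ d) powr \<alpha>" using assms by simp
  ultimately show ?thesis by (auto simp: divide_less_eq)
qed

theorem mainTheorem3:
  fixes b m :: nat
    and \<phi> :: "nat \<Rightarrow> real poly"
    and \<alpha> \<alpha>' :: real
    and p q :: ennreal
  assumes "2 \<le> b"
    and "is_basis_Pm m \<phi>"
    and "0 < \<alpha>" and "0 < \<alpha>'"
    and "0 < p" and "0 < q"
  shows "\<not> continuously_embedded
             (approx_class b m \<phi> \<alpha> q p) (approx_norm b m \<phi> \<alpha> q p)
             (besov_space \<alpha>' p q) (besov_norm \<alpha>' p q)"
proof
  assume "continuously_embedded
             (approx_class b m \<phi> \<alpha> q p) (approx_norm b m \<phi> \<alpha> q p)
             (besov_space \<alpha>' p q) (besov_norm \<alpha>' p q)"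
  then obtain C where C: "0 \<le> C"
    and emb: "\<And>f. f \<in> approx_class b m \<phi> \<alpha> q p \<Longrightarrow>
               besov_norm \<alpha>' p q f \<le> ennreal C * approx_norm b m \<phi> \<alpha> q p f"
    unfolding continuously_embedded_def by blast
  define r where "r = nat \<lfloor>\<alpha>'\<rfloor> + 1"
  define \<beta> where "\<beta> = \<alpha> + 1 / enn2real q"
  define \<delta> where "\<delta> = (1 / (real b * real r)) powr (1 / enn2real p)"
  define c where "c = (real r / 2) powr \<alpha>' * \<delta> * (1/2) powr (1 / enn2real q)"
  have r: "1 \<le> r" and \<delta>: "0 < \<delta>" and c: "0 < c"
    using \<open>2 \<le> b\<close> by (auto simp: r_def \<delta>_def c_def)
  obtain d where d: "2 \<le> d"
    and less: "C * (real b * real d + (real m + 1)) powr \<beta> < c * (real b ^ d) powr \<alpha>'"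
    using exponential_beats_power[of "real b" c \<alpha>' "real m + 1" C \<beta>] \<open>2 \<le> b\<close> \<open>0 < \<alpha>'\<close> c by auto
  define f where "f = digit_zero b d"
  define N where "N = b * d + m + 1"
  have f1: "Lp_norm p f \<le> 1"
    unfolding f_def by (intro Lp_norm_le_1 digit_zero_measurable digit_zero_bounds)
  have norm_f: "approx_norm b m \<phi> \<alpha> q p f \<le> ennreal (real N powr \<beta>)"
    unfolding \<beta>_def
    by (rule approx_norm_le[OF _ f1 \<open>0 < \<alpha>\<close> \<open>0 < q\<close>])
       (use digit_zero_tn assms d in \<open>auto simp: f_def N_def\<close>)
  have "f \<in> approx_class b m \<phi> \<alpha> q p"
    using norm_f f1 digit_zero_measurable[of b d]
    by (auto simp: approx_class_def Lp_functions_def f_def order_le_less_trans)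
  then have "besov_norm \<alpha>' p q f \<le> ennreal C * ennreal (real N powr \<beta>)"
    using emb norm_f by (meson mult_left_mono order_trans zero_le)
  also have "\<dots> = ennreal (C * real N powr \<beta>)"
    using C by (simp add: ennreal_mult)
  finally have upper: "besov_norm \<alpha>' p q f \<le> ennreal (C * real N powr \<beta>)" .
  define h where "h = 1 / (real r * real b ^ d)"
  have "2 \<le> real r * real b ^ d"
  proof -
    have "(2::real) ^ 1 \<le> 2 ^ d" using d by (intro power_increasing) auto
    also have "\<dots> \<le> real b ^ d" using \<open>2 \<le> b\<close> by (intro power_mono) auto
    finally have "1 * 2 \<le> real r * real b ^ d" using r by (intro mult_mono) auto
    then show ?thesis by simp
  qed
  then have h: "0 < h" "h \<le> 1/2"
    using r \<open>2 \<le> b\<close> by (auto simp: h_def field_simps)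
  have "ennreal \<delta> \<le> Lp_norm_on {0..<1 - real r * h} p ((fwd_diff h ^^ r) f)"
    unfolding \<delta>_def h_def f_def
    using \<open>2 \<le> b\<close> d r by (intro digit_zero_diff_norm_ge) auto
  then have "ennreal ((2 * h) powr - \<alpha>' * \<delta> * (1/2) powr (1 / enn2real q)) \<le> besov_norm \<alpha>' p q f"
    unfolding r_def using h \<delta> assms by (intro besov_norm_ge) auto
  moreover have "(2 * h) powr - \<alpha>' = (real r / 2) powr \<alpha>' * (real b ^ d) powr \<alpha>'"
  proof -
    have "(2 * h) powr - \<alpha>' = (real r / 2 * real b ^ d) powr \<alpha>'"
      using r \<open>2 \<le> b\<close> by (simp add: h_def powr_minus powr_divide powr_mult field_simps)
    also have "\<dots> = (real r / 2) powr \<alpha>' * (real b ^ d) powr \<alpha>'"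
      by (rule powr_mult)
    finally show ?thesis .
  qed
  ultimately have "ennreal (c * (real b ^ d) powr \<alpha>') \<le> besov_norm \<alpha>' p q f"
    by (simp add: c_def mult_ac)
  with upper have "ennreal (c * (real b ^ d) powr \<alpha>') \<le> ennreal (C * real N powr \<beta>)"
    by (rule order_trans[rotated])
  then have "c * (real b ^ d) powr \<alpha>' \<le> C * real N powr \<beta>"
    using C by (subst (asm) ennreal_le_iff) auto
  with less show False
    by (simp add: N_def add_ac)
qed

end
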